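(* For any finite simple graphs $G$ and $H$, \[\chi_{v}(G \times H) = \min\{\chi_{v}(G), \chi_{v}(H)\}.\]
   Context: For a real number $t \ge 1$, a vector $t$-coloring of a graph $G$ with vertex set $[n]$ is an assignment $i \mapsto p_i$ of real vectors such that $p_i^Tp_i = t-1$ for all $i \in [n]$ and $p_i^Tp_j \le -1$ whenever $i$ and $j$ are adjacent. The vector chromatic number $\chi_{v}(G)$ is the least real $t$ such that $G$ admits a vector $t$-coloring. The categorical product $G \times H$ has vertex set $V(G) \times V(H)$, with $(i,\ell)$ adjacent to $(j,k)$ iff $i \sim j$ in $G$ and $\ell \sim k$ in $H$. *)

theory Defs
  imports Complex_Main "Graph_Theory.Pair_Digraph" "Jordan_Normal_Form.Matrix"
begin

text \<open>
  A finite simple graph is a \<open>pair_graph\<close>: finite vertex set, symmetric and irreflexive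
  adjacency relation \<open>parcs G\<close> on it.  The dimension \<open>d\<close> of the vectors is not prescribed.
\<close>

definition vector_coloring ::
  "'a pair_pre_digraph \<Rightarrow> real \<Rightarrow> nat \<Rightarrow> ('a \<Rightarrow> real vec) \<Rightarrow> bool" where
  "vector_coloring G t d p \<longleftrightarrow>
     (\<forall>i\<in>pverts G. p i \<in> carrier_vec d) \<and>
     (\<forall>i\<in>pverts G. p i \<bullet> p i = t - 1) \<and>
     (\<forall>i\<in>pverts G. \<forall>j\<in>pverts G. i \<rightarrow>\<^bsub>with_proj G\<^esub> j \<longrightarrow> p i \<bullet> p j \<le> - 1)"

text \<open>
  For a finite loopless graph the minimum exists: the colorings can be taken in dimension
  \<open>card (pverts G)\<close>, and their Gram matrices form a nonempty closed set, bounded for bounded \<open>t\<close>.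
\<close>

definition vector_chromatic_number :: "'a pair_pre_digraph \<Rightarrow> real" where
  "vector_chromatic_number G = (LEAST t. t \<ge> 1 \<and> (\<exists>d p. vector_coloring G t d p))"

definition categorical_product ::
  "'a pair_pre_digraph \<Rightarrow> 'b pair_pre_digraph \<Rightarrow> ('a \<times> 'b) pair_pre_digraph" where
  "categorical_product G H =
     \<lparr> pverts = pverts G \<times> pverts H,
       parcs = {((i, l), (j, k)) | i l j k. i \<rightarrow>\<^bsub>with_proj G\<^esub> j \<and> l \<rightarrow>\<^bsub>with_proj H\<^esub> k} \<rparr>"

lemma pair_graph_categorical_product:
  assumes "pair_graph G" and "pair_graph H"
  shows "pair_graph (categorical_product G H)"
proof -
  interpret G: pair_graph G by fact
  interpret H: pair_graph H by fact
  let ?P = "categorical_product G H"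
  have sub: "parcs ?P \<subseteq> pverts ?P \<times> pverts ?P"
    by (auto simp: categorical_product_def dest: G.wellformed' H.wellformed')
  have fin: "finite (pverts ?P)"
    by (simp add: categorical_product_def G.pair_finite_verts H.pair_finite_verts)
  have "finite (parcs ?P)"
    using finite_subset[OF sub] fin by blast
  moreover have "sym (parcs ?P)"
    using G.sym_arcs H.sym_arcs
    by (auto simp: categorical_product_def symmetric_def sym_def)
  moreover have "fst e \<noteq> snd e" if "e \<in> parcs ?P" for e
    using that by (auto simp: categorical_product_def dest: G.no_loops')
  ultimately show ?thesis
    using sub fin by unfold_locales (auto simp: symmetric_def)
qed

end

theory Submission
  imports Defs "HOL-Analysis.Function_Topology"
begin

text \<open>
  A coloring of \<open>G\<close> or of \<open>H\<close> lifts to \<open>G \<times> H\<close> along a projection, so the point is that a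
  \<open>t\<close>-coloring of \<open>G \<times> H\<close> forces one of \<open>G\<close> or of \<open>H\<close>.  Put \<open>s = t - 1\<close>.  If \<open>G\<close> has no
  \<open>t\<close>-coloring, minimise over the positive semidefinite kernels \<open>X\<close> the total squared violation of
  the coloring constraints; the first-order conditions at the minimum yield edge weights \<open>W \<ge> 0\<close>
  and a diagonal \<open>D\<close> with \<open>W + D \<succeq> 0\<close> and \<open>\<Sum>W > s \<Sum>D\<close>.  Hence the largest generalized
  eigenvalue \<open>\<alpha>\<close> of \<open>(W, D)\<close> exceeds \<open>s\<close> whereas the least one is at least \<open>-1\<close>, and \<open>\<alpha>\<close> has a
  nonnegative eigenvector \<open>x\<close> because \<open>W \<ge> 0\<close>.  If \<open>H\<close> also has no \<open>t\<close>-coloring, there are such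
  \<open>U\<close>, \<open>E\<close>, \<open>\<beta>\<close>, \<open>y\<close> for \<open>H\<close>.  The eigenvalues of the pair \<open>(W \<otimes> U, D \<otimes> E)\<close> are products, so
  \<open>W \<otimes> U + max \<alpha> \<beta> (D \<otimes> E) \<succeq> 0\<close>.  Pairing this with the Gram matrix of a \<open>t\<close>-coloring of
  \<open>G \<times> H\<close>, rescaled by \<open>x \<otimes> y\<close>, gives \<open>\<alpha> \<beta> \<le> s max \<alpha> \<beta>\<close>, that is \<open>min \<alpha> \<beta> \<le> s\<close>,
  a contradiction.
\<close>

section \<open>Positive semidefinite kernels\<close>

text \<open>Kernels indexed by the vertices themselves avoid a numbering of the vertices and let a
  product of vertex sets serve as index set directly. Values off \<open>V\<close> are
  unconstrained.\<close>

definition psd_on :: "'a set \<Rightarrow> ('a \<Rightarrow> 'a \<Rightarrow> real) \<Rightarrow> bool" where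
  "psd_on V K \<longleftrightarrow> (\<forall>i\<in>V. \<forall>j\<in>V. K i j = K j i) \<and>
     (\<forall>z. 0 \<le> (\<Sum>i\<in>V. \<Sum>j\<in>V. K i j * z i * z j))"

lemma psd_onI:
  assumes "\<And>i j. i \<in> V \<Longrightarrow> j \<in> V \<Longrightarrow> K i j = K j i"
    and "\<And>z. 0 \<le> (\<Sum>i\<in>V. \<Sum>j\<in>V. K i j * z i * z j)"
  shows "psd_on V K"
  using assms by (auto simp: psd_on_def)

lemma psd_on_sym: "psd_on V K \<Longrightarrow> i \<in> V \<Longrightarrow> j \<in> V \<Longrightarrow> K i j = K j i"
  by (auto simp: psd_on_def)

lemma psd_on_nonneg: "psd_on V K \<Longrightarrow> 0 \<le> (\<Sum>i\<in>V. \<Sum>j\<in>V. K i j * z i * z j)"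
  by (auto simp: psd_on_def)

lemma psd_on_cong:
  assumes "psd_on V K" and "\<And>i j. i \<in> V \<Longrightarrow> j \<in> V \<Longrightarrow> K i j = L i j"
  shows "psd_on V L"
proof -
  have "(\<Sum>i\<in>V. \<Sum>j\<in>V. L i j * z i * z j) = (\<Sum>i\<in>V. \<Sum>j\<in>V. K i j * z i * z j)" for z
    using assms(2) by simp
  then show ?thesis using assms by (simp add: psd_on_def)
qed

lemma psd_on_add:
  assumes "psd_on V K" and "psd_on V L"
  shows "psd_on V (\<lambda>i j. K i j + L i j)"
  using assms by (auto simp: psd_on_def distrib_right sum.distrib)

lemma psd_on_scale:
  assumes "psd_on V K" and "0 \<le> c"
  shows "psd_on V (\<lambda>i j. c * K i j)"
proof -
  have "(\<Sum>i\<in>V. \<Sum>j\<in>V. c * K i j * z i * z j) = c * (\<Sum>i\<in>V. \<Sum>j\<in>V. K i j * z i * z j)" for z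
    by (simp add: sum_distrib_left mult.assoc)
  then show ?thesis using assms by (simp add: psd_on_def)
qed

lemma psd_on_rank_one: "psd_on V (\<lambda>i j. f i * f j :: real)"
proof (rule psd_onI)
  fix z :: "'a \<Rightarrow> real"
  have "(\<Sum>i\<in>V. \<Sum>j\<in>V. f i * f j * z i * z j) = (\<Sum>i\<in>V. f i * z i)\<^sup>2"
    by (simp add: power2_eq_square sum_product mult_ac)
  then show "0 \<le> (\<Sum>i\<in>V. \<Sum>j\<in>V. f i * f j * z i * z j)" by simp
qed (simp add: mult.commute)

lemma sum_if_eq_diag:
  fixes d x :: "'a \<Rightarrow> real"
  assumes "finite V"
  shows "(\<Sum>i\<in>V. \<Sum>j\<in>V. (if i = j then d i else 0) * x i * x j) = (\<Sum>i\<in>V. d i * (x i)\<^sup>2)"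
proof (intro sum.cong refl)
  fix i assume i: "i \<in> V"
  have "(\<Sum>j\<in>V. (if i = j then d i else 0) * x i * x j) = (\<Sum>j\<in>V. if i = j then d i * x i * x j else 0)"
    by (intro sum.cong) auto
  then show "(\<Sum>j\<in>V. (if i = j then d i else 0) * x i * x j) = d i * (x i)\<^sup>2"
    using i assms by (simp add: power2_eq_square mult.assoc)
qed

lemma psd_on_diag:
  assumes "finite V" and "\<And>i. i \<in> V \<Longrightarrow> 0 \<le> c i"
  shows "psd_on V (\<lambda>i j. if i = j then c i else 0)"
  using assms by (intro psd_onI) (auto simp: sum_if_eq_diag intro!: sum_nonneg)

text \<open>A test vector on \<open>U\<close>, extended by zero, is a test vector on
  \<open>V\<close>. The cases of one and two vertices yield the facts about diagonal entries and
  2-by-2 minors below.\<close>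

lemma psd_on_mono:
  assumes "psd_on V K" and "U \<subseteq> V" and "finite V"
  shows "psd_on U K"
proof (rule psd_onI)
  fix z :: "'a \<Rightarrow> real"
  let ?z = "\<lambda>i. if i \<in> U then z i else 0"
  have "(\<Sum>i\<in>U. \<Sum>j\<in>U. K i j * z i * z j) = (\<Sum>i\<in>V. \<Sum>j\<in>V. K i j * ?z i * ?z j)"
    using assms(2,3) by (intro sum.mono_neutral_cong_left) (auto intro!: sum.mono_neutral_cong_left)
  then show "0 \<le> (\<Sum>i\<in>U. \<Sum>j\<in>U. K i j * z i * z j)"
    using psd_on_nonneg[OF assms(1)] by simp
qed (meson assms psd_on_sym subsetD)

lemma psd_on_diag_nonneg:
  assumes "psd_on V K" and "finite V" and "i \<in> V"
  shows "0 \<le> K i i"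
  using psd_on_nonneg[OF psd_on_mono[OF assms(1), of "{i}"], of "\<lambda>_. 1"] assms by simp

lemma psd_on_two:
  assumes "psd_on V K" and "finite V" and "i \<in> V" and "j \<in> V" and "i \<noteq> j"
  shows "0 \<le> K i i * a\<^sup>2 + 2 * K i j * a * b + K j j * b\<^sup>2"
  using psd_on_nonneg[OF psd_on_mono[OF assms(1), of "{i,j}"], of "\<lambda>k. if k = i then a else b"]
    assms psd_on_sym[OF assms(1,3,4)] by (simp add: power2_eq_square algebra_simps)

text \<open>Test vectors (1, 1) and (1, -1) give
  \<open>2 * \<bar>K i j\<bar> \<le> K i i + K j j\<close>. A bound on the diagonal therefore bounds
  the whole kernel, which is the source of compactness later.\<close>

lemma psd_on_abs_le:
  assumes "psd_on V K" and "finite V" and "i \<in> V" and "j \<in> V"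
    and "K i i \<le> R" and "K j j \<le> R"
  shows "\<bar>K i j\<bar> \<le> R"
proof (cases "i = j")
  case True
  then show ?thesis using assms psd_on_diag_nonneg[OF assms(1,2,3)] by simp
next
  case False
  show ?thesis
    using psd_on_two[OF assms(1-4) False, of 1 1] psd_on_two[OF assms(1-4) False, of 1 "-1"] assms(5,6)
    by simp
qed

lemma psd_on_zero_row:
  assumes "psd_on V K" and "finite V" and "i \<in> V" and "j \<in> V" and "K i i = 0"
  shows "K i j = 0"
proof (cases "i = j")
  case False
  have jj: "0 \<le> K j j" using psd_on_diag_nonneg[OF assms(1,2,4)] .
  show ?thesis
  proof (rule ccontr)
    assume nz: "K i j \<noteq> 0"
    \<comment> \<open>With \<open>K i i = 0\<close> the form is affine in the first weight; this
      weight gives it the value \<open>- K j j - 2\<close>.\<close>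
    from psd_on_two[OF assms(1-4) False, of "- (K j j + 1) / K i j" 1] assms(5) nz jj
    show False by simp
  qed
qed (use assms in simp)

text \<open>Cholesky factorization by induction on \<open>V\<close>: split off the rank-one part
  belonging to a new vertex and factor the Schur complement on the remaining ones. Both the vectors
  of a coloring and the Schur product theorem come from it.\<close>

lemma psd_on_gram:
  assumes "finite V" and "psd_on V K"
  shows "\<exists>n f. \<forall>i\<in>V. \<forall>j\<in>V. K i j = (\<Sum>m<n::nat. f m i * f m j)"
  using assms
proof (induction V arbitrary: K rule: finite_induct)
  case empty
  then show ?case by simp
next
  case (insert a V)
  have fin: "finite (insert a V)" using insert.hyps by simp
  have sym: "K i j = K j i" if "i \<in> insert a V" "j \<in> insert a V" for i j
    using psd_on_sym[OF insert.prems] that by blast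
  have aa: "0 \<le> K a a" using psd_on_diag_nonneg[OF insert.prems fin] by simp
  have row: "K a j = 0" if "K a a = 0" "j \<in> insert a V" for j
    using psd_on_zero_row[OF insert.prems fin _ that(2)] that(1) by blast
  \<comment> \<open>the Schur complement of \<open>a\<close>; if \<open>K a a = 0\<close> the quotient is the junk value \<open>0\<close>, which is
    right because then the whole row vanishes\<close>
  define L where "L i j = K i j - K a i * K a j / K a a" for i j
  have "psd_on V L"
  proof (rule psd_onI)
    fix i j assume "i \<in> V" "j \<in> V"
    then show "L i j = L j i" using sym[of i j] by (simp add: L_def mult.commute)
  next
    fix z :: "'a \<Rightarrow> real"
    define b where "b = (\<Sum>j\<in>V. K a j * z j)"
    \<comment> \<open>Completing the square: this \<open>y a\<close> minimises the form of
      \<open>K\<close> in the \<open>a\<close>-coordinate, and the minimum is the form of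
      \<open>L\<close> at \<open>z\<close>.\<close>
    define y where "y i = (if i = a then - b / K a a else z i)" for i
    have yV: "(\<Sum>i\<in>V. f i * y i) = (\<Sum>i\<in>V. f i * z i)" for f
      using insert.hyps by (intro sum.cong) (auto simp: y_def)
    have bsq: "b\<^sup>2 = (\<Sum>i\<in>V. \<Sum>j\<in>V. K a i * K a j * z i * z j)"
      by (simp add: b_def power2_eq_square sum_product mult_ac)
    have "(\<Sum>i\<in>insert a V. \<Sum>j\<in>insert a V. K i j * y i * y j)
      = K a a * y a * y a + y a * (\<Sum>j\<in>V. K a j * y j) + y a * (\<Sum>i\<in>V. K i a * y i)
        + (\<Sum>i\<in>V. \<Sum>j\<in>V. K i j * y i * y j)"
      using insert.hyps by (simp add: sum.distrib sum_distrib_left mult_ac)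
    also have "(\<Sum>i\<in>V. K i a * y i) = b"
      unfolding yV b_def using sym by (intro sum.cong) auto
    also have "(\<Sum>j\<in>V. K a j * y j) = b" unfolding yV b_def ..
    also have "(\<Sum>i\<in>V. \<Sum>j\<in>V. K i j * y i * y j) = (\<Sum>i\<in>V. \<Sum>j\<in>V. K i j * z i * z j)"
      using insert.hyps by (intro sum.cong) (auto simp: y_def)
    also have "K a a * y a * y a + y a * b + y a * b = - b\<^sup>2 / K a a"
      by (simp add: y_def power2_eq_square)
    also have "- b\<^sup>2 / K a a + (\<Sum>i\<in>V. \<Sum>j\<in>V. K i j * z i * z j)
        = (\<Sum>i\<in>V. \<Sum>j\<in>V. L i j * z i * z j)"
      unfolding bsq L_def
      by (simp add: sum_subtractf left_diff_distrib sum_divide_distrib)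
    finally show "0 \<le> (\<Sum>i\<in>V. \<Sum>j\<in>V. L i j * z i * z j)"
      using psd_on_nonneg[OF insert.prems, of y] by argo
  qed
  from insert.IH[OF this] obtain n and f :: "nat \<Rightarrow> 'a \<Rightarrow> real"
    where f: "\<And>i j. i \<in> V \<Longrightarrow> j \<in> V \<Longrightarrow> L i j = (\<Sum>m<n. f m i * f m j)" by blast
  \<comment> \<open>The coordinate split off gets index \<open>n\<close>. The old coordinates are
    set to 0 at \<open>a\<close>, where \<open>f\<close> is arbitrary.\<close>
  define g where "g m i = (if m = n then K a i / sqrt (K a a) else if i = a then 0 else f m i)"
    for m i
  have "K i j = (\<Sum>m<Suc n. g m i * g m j)" if i: "i \<in> insert a V" and j: "j \<in> insert a V" for i j
  proof -
    have s: "(\<Sum>m<Suc n. g m i * g m j) = (\<Sum>m<n. g m i * g m j) + K a i * K a j / K a a"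
      using aa by (simp add: g_def)
    show ?thesis
    proof (cases "i = a \<or> j = a")
      case True
      then have "(\<Sum>m<n. g m i * g m j) = 0" by (auto simp: g_def intro!: sum.neutral)
      moreover have "K a i * K a j / K a a = K i j"
        using True row i j sym[OF i j] by (cases "K a a = 0") auto
      ultimately show ?thesis using s by simp
    next
      case False
      then have "(\<Sum>m<n. g m i * g m j) = L i j"
        using f[of i j] i j by (auto simp: g_def intro!: sum.cong)
      then show ?thesis using s by (simp add: L_def)
    qed
  qed
  then show ?case by blast
qed

section \<open>Closure properties and the Schur product theorem\<close>

lemma psd_on_sum:
  assumes "\<And>m. m < n \<Longrightarrow> psd_on V (K m)"
  shows "psd_on V (\<lambda>i j. \<Sum>m<n::nat. K m i j)"
  using assms by (induction n) (simp_all add: psd_on_add, simp add: psd_on_def)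

lemma psd_on_congruence:
  assumes "psd_on V K"
  shows "psd_on V (\<lambda>i j. K i j * (f i * f j))"
proof (rule psd_onI)
  fix z :: "'a \<Rightarrow> real"
  show "0 \<le> (\<Sum>i\<in>V. \<Sum>j\<in>V. K i j * (f i * f j) * z i * z j)"
    using psd_on_nonneg[OF assms, of "\<lambda>i. f i * z i"] by (simp add: mult_ac)
qed (simp add: psd_on_sym[OF assms] mult.commute)

text \<open>A Gram factorization of \<open>L\<close> turns the entrywise product into a sum of
  diagonal congruences of \<open>K\<close>.\<close>

lemma psd_on_schur:
  assumes "finite V" and "psd_on V K" and "psd_on V L"
  shows "psd_on V (\<lambda>i j. K i j * L i j)"
proof -
  obtain n and f :: "nat \<Rightarrow> 'a \<Rightarrow> real"
    where f: "\<And>i j. i \<in> V \<Longrightarrow> j \<in> V \<Longrightarrow> L i j = (\<Sum>m<n. f m i * f m j)"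
    using psd_on_gram[OF assms(1,3)] by blast
  have "psd_on V (\<lambda>i j. \<Sum>m<n. K i j * (f m i * f m j))"
    by (intro psd_on_sum psd_on_congruence assms(2))
  then show ?thesis by (rule psd_on_cong) (simp add: f sum_distrib_left)
qed

text \<open>Give \<open>a\<close> the Gram vector of \<open>g a\<close>. The map \<open>g\<close>
  may identify points, as the projections \<open>fst\<close> and \<open>snd\<close> do.\<close>

lemma psd_on_pullback:
  assumes "finite V" and "psd_on V K" and "g ` A \<subseteq> V"
  shows "psd_on A (\<lambda>a b. K (g a) (g b))"
proof -
  obtain n and f :: "nat \<Rightarrow> 'a \<Rightarrow> real"
    where f: "\<And>i j. i \<in> V \<Longrightarrow> j \<in> V \<Longrightarrow> K i j = (\<Sum>m<n. f m i * f m j)"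
    using psd_on_gram[OF assms(1,2)] by blast
  have "psd_on A (\<lambda>a b. \<Sum>m<n. f m (g a) * f m (g b))"
    by (intro psd_on_sum psd_on_rank_one)
  then show ?thesis by (rule psd_on_cong) (use assms(3) in \<open>simp add: f image_subset_iff\<close>)
qed

text \<open>The Kronecker product is the entrywise product of the pullbacks along the two
  projections.\<close>

lemma psd_on_kronecker:
  assumes "finite V" and "finite U" and "psd_on V K" and "psd_on U L"
  shows "psd_on (V \<times> U) (\<lambda>a b. K (fst a) (fst b) * L (snd a) (snd b))"
  using assms by (intro psd_on_schur psd_on_pullback[of V K fst] psd_on_pullback[of U L snd]) auto

section \<open>Compactness and the least coloring\<close>

text \<open>Tychonoff's theorem, for function types under the topology of pointwise
  convergence.\<close>

lemma compact_function_box: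
  assumes "\<And>i. compact (B i)"
  shows "compact {f. \<forall>i. f i \<in> B i}"
proof -
  have "compactin (product_topology (\<lambda>_. euclidean) UNIV) (PiE UNIV B)"
    using assms by (simp add: compactin_PiE)
  moreover have "PiE UNIV B = {f. \<forall>i. f i \<in> B i}" by (auto simp: PiE_def)
  ultimately show ?thesis by (simp add: euclidean_product_topology)
qed

text \<open>Pinning the entries off \<open>V\<close> to 0 makes the set compact in the full function
  space; the diagonal bound controls the other entries.\<close>

definition psd_kernels :: "'a set \<Rightarrow> real \<Rightarrow> ('a \<Rightarrow> 'a \<Rightarrow> real) set" where
  "psd_kernels V R = {X. psd_on V X \<and> (\<forall>i\<in>V. X i i \<le> R) \<and> (\<forall>i j. i \<notin> V \<or> j \<notin> V \<longrightarrow> X i j = 0)}"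

lemma continuous_on_entry: "continuous_on S (\<lambda>X. X i j)"
  for S :: "('a \<Rightarrow> 'b \<Rightarrow> real) set"
  by (rule continuous_on_product_then_coordinatewise[OF
        continuous_on_product_then_coordinatewise[OF continuous_on_id]])

lemma compact_psd_kernels:
  assumes "finite V"
  shows "compact (psd_kernels V R)"
proof -
  let ?B = "\<lambda>i j. if i \<in> V \<and> j \<in> V then {- R..R} else {0::real}"
  let ?box = "{X. \<forall>i. X i \<in> {x. \<forall>j. x j \<in> ?B i j}}"
  have "compact ?box"
    by (intro compact_function_box) simp
  moreover have "closed {X. psd_on V X \<and> (\<forall>i\<in>V. X i i \<le> R)}"
    unfolding psd_on_def Ball_def
    by (intro closed_Collect_conj closed_Collect_all closed_Collect_imp open_Collect_const
        closed_Collect_le closed_Collect_eq continuous_intros continuous_on_entry)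
  ultimately have "compact (?box \<inter> {X. psd_on V X \<and> (\<forall>i\<in>V. X i i \<le> R)})"
    by (rule compact_Int_closed)
  moreover have "?box \<inter> {X. psd_on V X \<and> (\<forall>i\<in>V. X i i \<le> R)} = psd_kernels V R"
  proof (intro equalityI subsetI)
    fix X assume X: "X \<in> psd_kernels V R"
    then have "\<bar>X i j\<bar> \<le> R" if "i \<in> V" "j \<in> V" for i j
      using psd_on_abs_le[OF _ assms that] that by (simp add: psd_kernels_def)
    then show "X \<in> ?box \<inter> {X. psd_on V X \<and> (\<forall>i\<in>V. X i i \<le> R)}"
      using X by (auto simp: psd_kernels_def abs_le_iff minus_le_iff)
  next
    fix X assume X: "X \<in> ?box \<inter> {X. psd_on V X \<and> (\<forall>i\<in>V. X i i \<le> R)}"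
    have "X i j = 0" if "i \<notin> V \<or> j \<notin> V" for i j
    proof -
      have "X i j \<in> ?B i j" using X by blast
      then show ?thesis using that by (simp split: if_splits)
    qed
    then show "X \<in> psd_kernels V R" using X by (simp add: psd_kernels_def)
  qed
  ultimately show ?thesis by simp
qed

section \<open>Colorings as Gram kernels\<close>

lemma restrict_in_psd_kernels:
  assumes "psd_on V X" and "\<And>i. i \<in> V \<Longrightarrow> X i i \<le> R"
  shows "(\<lambda>i j. if i \<in> V \<and> j \<in> V then X i j else 0) \<in> psd_kernels V R"
  unfolding psd_kernels_def using assms(2) by (auto intro: psd_on_cong[OF assms(1)])

text \<open>The Gram matrix of a vector coloring with \<open>s = t - 1\<close>. It does not mention
  the dimension, so colorings become points of one fixed space.\<close>

definition gram_coloring ::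
  "'a set \<Rightarrow> ('a \<times> 'a) set \<Rightarrow> real \<Rightarrow> ('a \<Rightarrow> 'a \<Rightarrow> real) \<Rightarrow> bool" where
  "gram_coloring V E s X \<longleftrightarrow>
     psd_on V X \<and> (\<forall>i\<in>V. X i i = s) \<and> (\<forall>(i, j)\<in>E. X i j \<le> - 1)"

lemma vector_coloring_iff_gram:
  fixes G :: "'a pair_pre_digraph"
  assumes "pair_graph G"
  shows "(\<exists>d p. vector_coloring G t d p) \<longleftrightarrow> (\<exists>X. gram_coloring (pverts G) (parcs G) (t - 1) X)"
proof
  interpret pair_graph G by fact
  assume "\<exists>d p. vector_coloring G t d p"
  then obtain d p where p: "vector_coloring G t d p" by blast
  define X where "X i j = p i \<bullet> p j" for i j
  have X: "X i j = (\<Sum>m<d. p i $ m * p j $ m)" if "i \<in> pverts G" "j \<in> pverts G" for i j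
    using p that by (auto simp: X_def vector_coloring_def scalar_prod_def atLeast0LessThan dest: carrier_vecD)
  have "psd_on (pverts G) (\<lambda>i j. \<Sum>m<d. p i $ m * p j $ m)"
    by (induction d) (simp_all add: psd_on_add psd_on_rank_one, simp add: psd_on_def)
  then have "psd_on (pverts G) X" by (rule psd_on_cong) (simp add: X)
  then have "gram_coloring (pverts G) (parcs G) (t - 1) X"
    using p by (auto simp: gram_coloring_def vector_coloring_def X_def in_arcsD1 in_arcsD2)
  then show "\<exists>X. gram_coloring (pverts G) (parcs G) (t - 1) X" by blast
next
  interpret pair_graph G by fact
  assume "\<exists>X. gram_coloring (pverts G) (parcs G) (t - 1) X"
  then obtain X where X: "gram_coloring (pverts G) (parcs G) (t - 1) X" ..
  then have "psd_on (pverts G) X" by (simp add: gram_coloring_def)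
  from psd_on_gram[OF pair_finite_verts this] obtain n and f :: "nat \<Rightarrow> 'a \<Rightarrow> real"
    where f: "\<And>i j. i \<in> pverts G \<Longrightarrow> j \<in> pverts G \<Longrightarrow> X i j = (\<Sum>m<n. f m i * f m j)" by blast
  define p where "p i = vec n (\<lambda>m. f m i)" for i
  have "p i \<bullet> p j = X i j" if "i \<in> pverts G" "j \<in> pverts G" for i j
    using f[OF that] by (simp add: p_def scalar_prod_def atLeast0LessThan)
  then have "vector_coloring G t n p"
    using X by (auto simp: gram_coloring_def vector_coloring_def p_def)
  then show "\<exists>d p. vector_coloring G t d p" by blast
qed

text \<open>The regular simplex colors every finite loopless graph. Its Gram kernel is psd because n
  times the sum of squares minus the square of the sum is half the sum of all squared
  differences.\<close>

lemma gram_coloring_card: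
  assumes "finite V" and "E \<subseteq> V \<times> V" and "\<And>i. (i, i) \<notin> E"
  shows "gram_coloring V E (real (card V) - 1) (\<lambda>i j. (if i = j then real (card V) else 0) - 1)"
proof -
  have "psd_on V (\<lambda>i j. (if i = j then real (card V) else 0) - 1)"
  proof (rule psd_onI)
    fix z :: "'a \<Rightarrow> real"
    have "(\<Sum>i\<in>V. \<Sum>j\<in>V. ((if i = j then real (card V) else 0) - 1) * z i * z j)
        = real (card V) * (\<Sum>i\<in>V. (z i)\<^sup>2) - (\<Sum>i\<in>V. z i)\<^sup>2"
    proof -
      have "(\<Sum>j\<in>V. ((if i = j then real (card V) else 0) - 1) * z i * z j)
          = real (card V) * (z i)\<^sup>2 - z i * (\<Sum>j\<in>V. z j)" if "i \<in> V" for i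
      proof -
        have "(\<Sum>j\<in>V. ((if i = j then real (card V) else 0) - 1) * z i * z j)
           = (\<Sum>j\<in>V. (if i = j then real (card V) * z i * z j else 0) - z i * z j)"
          by (intro sum.cong) (auto simp: algebra_simps)
        then show ?thesis using that assms(1)
          by (simp add: sum_subtractf sum_distrib_left power2_eq_square)
      qed
      then show ?thesis
        by (simp add: sum_subtractf power2_eq_square sum_product flip: sum_distrib_left)
    qed
    also have "\<dots> \<ge> 0"
    proof -
      have "(\<Sum>i\<in>V. \<Sum>j\<in>V. (z i - z j)\<^sup>2)
          = 2 * (real (card V) * (\<Sum>i\<in>V. (z i)\<^sup>2) - (\<Sum>i\<in>V. z i)\<^sup>2)"
        by (simp add: power2_diff sum.distrib sum_subtractf mult.assoc
            power2_eq_square[of "sum z V"] sum_product flip: sum_distrib_left)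
      moreover have "0 \<le> (\<Sum>i\<in>V. \<Sum>j\<in>V. (z i - z j)\<^sup>2)" by (intro sum_nonneg) simp
      ultimately show ?thesis by simp
    qed
    finally show "0 \<le> (\<Sum>i\<in>V. \<Sum>j\<in>V. ((if i = j then real (card V) else 0) - 1) * z i * z j)" .
  qed auto
  then show ?thesis using assms(3) by (auto simp: gram_coloring_def)
qed

lemma least_gram_coloring:
  assumes "finite V" and "V \<noteq> {}" and "E \<subseteq> V \<times> V" and "\<And>i. (i, i) \<notin> E"
  obtains s where "0 \<le> s" and "\<exists>X. gram_coloring V E s X"
    and "\<And>s' X. gram_coloring V E s' X \<Longrightarrow> s \<le> s'"
proof -
  obtain a where a: "a \<in> V" using assms(2) by blast
  define n where "n = real (card V) - 1"
  \<comment> \<open>The parameter \<open>s\<close> is read off as the common diagonal entry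
    \<open>X a a\<close>, a continuous function to be minimised. Capping it at \<open>n\<close>, the
    simplex value, makes the domain compact without losing the minimum.\<close>
  define C where "C = psd_kernels V n \<inter> {X. (\<forall>i\<in>V. X i i = X a a) \<and> (\<forall>e\<in>E. X (fst e) (snd e) \<le> - 1)}"
  have restrict: "(\<lambda>i j. if i \<in> V \<and> j \<in> V then X i j else 0) \<in> C"
    if "gram_coloring V E s X" "s \<le> n" for s X
  proof -
    have "(\<lambda>i j. if i \<in> V \<and> j \<in> V then X i j else 0) \<in> psd_kernels V n"
      using that by (intro restrict_in_psd_kernels) (auto simp: gram_coloring_def)
    then show ?thesis using that(1) a assms(3) by (auto simp: C_def gram_coloring_def)
  qed
  have "compact C"
    unfolding C_def Ball_def
    by (intro compact_Int_closed compact_psd_kernels assms(1) closed_Collect_conj closed_Collect_all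
        closed_Collect_imp open_Collect_const closed_Collect_eq closed_Collect_le continuous_on_entry continuous_on_const)
  moreover have "C \<noteq> {}"
    using restrict[OF gram_coloring_card[OF assms(1,3,4)]] by (auto simp: n_def)
  ultimately obtain X where X: "X \<in> C" and min: "\<And>Y. Y \<in> C \<Longrightarrow> X a a \<le> Y a a"
    using continuous_attains_inf[OF _ _ continuous_on_entry, of C a a] by blast
  show ?thesis
  proof
    show "0 \<le> X a a"
      using X psd_on_diag_nonneg[OF _ assms(1) a, of X] by (simp add: C_def psd_kernels_def)
    show "\<exists>Y. gram_coloring V E (X a a) Y"
      using X by (intro exI[of _ X]) (auto simp: gram_coloring_def C_def psd_kernels_def)
    fix s' Y assume Y: "gram_coloring V E s' Y"
    have "X a a \<le> n" using X a unfolding C_def psd_kernels_def by blast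
    moreover have "X a a \<le> s'" if "s' \<le> n"
      using min[OF restrict[OF Y that]] Y a by (simp add: gram_coloring_def)
    ultimately show "X a a \<le> s'" by linarith
  qed
qed

section \<open>Dual certificates of non-colorability\<close>

text \<open>A one-sided second-order expansion of the squared positive part, with slope
  \<open>2 * max 0 a\<close>. It takes the place of differentiation in the first-order
  conditions.\<close>

lemma max_square_add_le:
  fixes a h :: real
  shows "(max 0 (a + h))\<^sup>2 \<le> (max 0 a)\<^sup>2 + 2 * (h * max 0 a) + h\<^sup>2"
proof -
  have "\<bar>max 0 (a + h)\<bar> \<le> \<bar>max 0 a + h\<bar>" by (auto simp: max_def)
  then have "(max 0 (a + h))\<^sup>2 \<le> (max 0 a + h)\<^sup>2" by (rule abs_le_square_iff[THEN iffD1])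
  then show ?thesis by (simp add: power2_sum algebra_simps)
qed

lemma nonneg_of_quadratic_perturbation:
  fixes I C \<delta> :: real
  assumes "0 < \<delta>" and "0 \<le> C" and "\<And>\<epsilon>. 0 < \<epsilon> \<Longrightarrow> \<epsilon> \<le> \<delta> \<Longrightarrow> 0 \<le> 2 * (\<epsilon> * I) + \<epsilon>\<^sup>2 * C"
  shows "0 \<le> I"
proof (rule ccontr)
  assume "\<not> 0 \<le> I"
  then have I: "I < 0" by simp
  \<comment> \<open>Small enough that \<open>e * C < - I\<close>, so the linear term wins;
    \<open>C + 1\<close> keeps the denominator positive when \<open>C = 0\<close>.\<close>
  define e where "e = min \<delta> (- I / (C + 1))"
  have e: "0 < e" "e \<le> \<delta>" using assms(1,2) I by (auto simp: e_def divide_neg_pos)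
  have "e * (C + 1) \<le> - I"
    using assms(2) by (simp add: e_def pos_le_divide_eq[symmetric])
  then have "2 * I + e * C < 0" using I e by (simp add: algebra_simps)
  then have "e * (2 * I + e * C) < 0" using e by (simp add: mult_pos_neg)
  then show False using assms(3)[OF e] by (simp add: power2_eq_square algebra_simps)
qed

text \<open>Only the positive part of an edge violation is penalised, and its square has a
  continuous derivative; half of that derivative becomes the edge weight of the certificate.\<close>

definition coloring_defect ::
  "'a set \<Rightarrow> ('a \<times> 'a) set \<Rightarrow> real \<Rightarrow> ('a \<Rightarrow> 'a \<Rightarrow> real) \<Rightarrow> real" where
  "coloring_defect V E s X =
     (\<Sum>i\<in>V. \<Sum>j\<in>V. if (i, j) \<in> E then (max 0 (X i j + 1))\<^sup>2 else 0) + (\<Sum>i\<in>V. (X i i - s)\<^sup>2)"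

lemma coloring_defect_nonneg: "0 \<le> coloring_defect V E s X"
  unfolding coloring_defect_def by (intro add_nonneg_nonneg sum_nonneg) auto

text \<open>The psd cone is not bounded, but a large diagonal entry makes the defect large, so the
  minimum over a compact set of kernels is global.\<close>

lemma coloring_defect_minimum:
  assumes "finite V"
  obtains X where "psd_on V X" and "\<And>Y. psd_on V Y \<Longrightarrow> coloring_defect V E s X \<le> coloring_defect V E s Y"
proof -
  let ?\<Phi> = "coloring_defect V E s"
  define R where "R = s + ?\<Phi> (\<lambda>_ _. 0) + 1 + \<bar>s\<bar>"
    \<comment> \<open>a diagonal entry above \<open>R\<close> alone already costs more than the zero kernel\<close>
  have zero: "(\<lambda>_ _. 0) \<in> psd_kernels V R"
    using coloring_defect_nonneg[of V E s "\<lambda>_ _. 0"] by (auto simp: psd_kernels_def psd_on_def R_def)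
  have "continuous_on (psd_kernels V R) ?\<Phi>"
    unfolding coloring_defect_def
  proof (intro continuous_on_add continuous_on_sum)
    fix i j
    show "continuous_on (psd_kernels V R) (\<lambda>X. if (i, j) \<in> E then (max 0 (X i j + 1))\<^sup>2 else 0)"
      by (cases "(i, j) \<in> E") (auto intro!: continuous_intros continuous_on_entry)
    show "continuous_on (psd_kernels V R) (\<lambda>X. (X i i - s)\<^sup>2)"
      by (intro continuous_intros continuous_on_entry)
  qed
  then obtain X where X: "X \<in> psd_kernels V R" and min: "\<And>Y. Y \<in> psd_kernels V R \<Longrightarrow> ?\<Phi> X \<le> ?\<Phi> Y"
    using continuous_attains_inf[OF compact_psd_kernels[OF assms]] zero by blast
  show ?thesis
  proof
    show "psd_on V X" using X by (simp add: psd_kernels_def)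
    fix Y assume Y: "psd_on V Y"
    show "?\<Phi> X \<le> ?\<Phi> Y"
    proof (cases "\<forall>i\<in>V. Y i i \<le> R")
      case True
      let ?Y = "\<lambda>i j. if i \<in> V \<and> j \<in> V then Y i j else 0"
      have "?\<Phi> X \<le> ?\<Phi> ?Y" using True by (intro min restrict_in_psd_kernels Y) auto
      also have "?\<Phi> ?Y = ?\<Phi> Y"
        unfolding coloring_defect_def by (intro arg_cong2[of _ _ _ _ "(+)"] sum.cong) auto
      finally show ?thesis .
    next
      case False
      then obtain i where i: "i \<in> V" "R < Y i i" by auto
      let ?c = "?\<Phi> (\<lambda>_ _. 0)"
      have c: "0 \<le> ?c" by (rule coloring_defect_nonneg)
      have "?\<Phi> X \<le> ?c" by (rule min[OF zero])
      also have "\<dots> \<le> (?c + 1)\<^sup>2" using c by (simp add: power2_eq_square algebra_simps)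
      also have "\<dots> \<le> (Y i i - s)\<^sup>2"
        using i c by (intro power_mono) (auto simp: R_def)
      also have "\<dots> \<le> (\<Sum>i\<in>V. (Y i i - s)\<^sup>2)"
        using i assms by (intro member_le_sum[of i V "\<lambda>i. (Y i i - s)\<^sup>2"]) auto
      also have "\<dots> \<le> ?\<Phi> Y"
        unfolding coloring_defect_def by (simp add: sum_nonneg)
      finally show ?thesis .
    qed
  qed
qed

text \<open>The certificate is half the gradient of the defect at its minimiser \<open>X\<close>.
  Rank-one directions show that it is psd, and shrinking \<open>X\<close> towards zero gives the
  trace inequality, strict because \<open>X\<close> is no coloring.\<close>

lemma coloring_certificate:
  fixes V :: "'a set"
  assumes "finite V" and E: "\<And>i j. (i, j) \<in> E \<Longrightarrow> i \<in> V \<and> j \<in> V \<and> i \<noteq> j"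
    and sym: "\<And>i j. (i, j) \<in> E \<Longrightarrow> (j, i) \<in> E"
    and "0 \<le> s" and no_coloring: "\<And>X. \<not> gram_coloring V E s X"
  obtains W d where "\<And>i j. 0 \<le> W i j" and "\<And>i j. (i, j) \<notin> E \<Longrightarrow> W i j = 0"
    and "\<And>i. i \<in> V \<Longrightarrow> 0 < d i"
    and "psd_on V (\<lambda>i j. W i j + (if i = j then d i else 0))"
    and "s * (\<Sum>i\<in>V. d i) < (\<Sum>i\<in>V. \<Sum>j\<in>V. W i j)"
proof -
  let ?\<Phi> = "coloring_defect V E s"
  obtain X where X: "psd_on V X" and min: "\<And>Y. psd_on V Y \<Longrightarrow> ?\<Phi> X \<le> ?\<Phi> Y"
    using coloring_defect_minimum[OF assms(1)] by blast
  define W where "W i j = (if (i, j) \<in> E then max 0 (X i j + 1) else 0)" for i j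
  define d where "d i = X i i - s" for i
  \<comment> \<open>Half the directional derivative of the defect at \<open>X\<close> along
    \<open>Y\<close>.\<close>
  define I where "I Y = (\<Sum>i\<in>V. \<Sum>j\<in>V. W i j * Y i j) + (\<Sum>i\<in>V. d i * Y i i)" for Y
  have expand: "?\<Phi> (\<lambda>i j. X i j + \<epsilon> * Y i j)
      \<le> ?\<Phi> X + 2 * (\<epsilon> * I Y) + \<epsilon>\<^sup>2 * ((\<Sum>i\<in>V. \<Sum>j\<in>V. (Y i j)\<^sup>2) + (\<Sum>i\<in>V. (Y i i)\<^sup>2))"
    for \<epsilon> :: real and Y
  proof -
    let ?a = "\<lambda>i j. (if (i, j) \<in> E then (max 0 (X i j + 1))\<^sup>2 else 0)
        + 2 * (\<epsilon> * (W i j * Y i j)) + \<epsilon>\<^sup>2 * (Y i j)\<^sup>2"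
    have "?\<Phi> (\<lambda>i j. X i j + \<epsilon> * Y i j)
      \<le> (\<Sum>i\<in>V. \<Sum>j\<in>V. ?a i j)
        + (\<Sum>i\<in>V. (X i i - s)\<^sup>2 + 2 * (\<epsilon> * (d i * Y i i)) + \<epsilon>\<^sup>2 * (Y i i)\<^sup>2)"
      unfolding coloring_defect_def
    proof (intro add_mono sum_mono)
      fix i j
      show "(if (i, j) \<in> E then (max 0 (X i j + \<epsilon> * Y i j + 1))\<^sup>2 else 0) \<le> ?a i j"
        using max_square_add_le[of "X i j + 1" "\<epsilon> * Y i j"]
        by (simp add: W_def power_mult_distrib algebra_simps)
      show "(X i i + \<epsilon> * Y i i - s)\<^sup>2 \<le> (X i i - s)\<^sup>2 + 2 * (\<epsilon> * (d i * Y i i)) + \<epsilon>\<^sup>2 * (Y i i)\<^sup>2"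
        by (simp add: d_def power2_eq_square algebra_simps)
    qed
    also have "\<dots> = ?\<Phi> X + 2 * (\<epsilon> * I Y)
        + \<epsilon>\<^sup>2 * ((\<Sum>i\<in>V. \<Sum>j\<in>V. (Y i j)\<^sup>2) + (\<Sum>i\<in>V. (Y i i)\<^sup>2))"
      by (simp add: coloring_defect_def I_def sum.distrib distrib_left flip: sum_distrib_left)
    finally show ?thesis .
  qed
  have first_order: "0 \<le> I Y"
    if "\<And>\<epsilon>. 0 < \<epsilon> \<Longrightarrow> \<epsilon> \<le> 1 \<Longrightarrow> psd_on V (\<lambda>i j. X i j + \<epsilon> * Y i j)" for Y
  proof (rule nonneg_of_quadratic_perturbation[of 1])
    show "0 \<le> (\<Sum>i\<in>V. \<Sum>j\<in>V. (Y i j)\<^sup>2) + (\<Sum>i\<in>V. (Y i i)\<^sup>2)"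
      by (intro add_nonneg_nonneg sum_nonneg) auto
    fix \<epsilon> :: real assume "0 < \<epsilon>" "\<epsilon> \<le> 1"
    from min[OF that[OF this]] expand[of \<epsilon> Y]
    show "0 \<le> 2 * (\<epsilon> * I Y) + \<epsilon>\<^sup>2 * ((\<Sum>i\<in>V. \<Sum>j\<in>V. (Y i j)\<^sup>2) + (\<Sum>i\<in>V. (Y i i)\<^sup>2))"
      by linarith
  qed simp
  let ?M = "\<lambda>i j. W i j + (if i = j then d i else 0)"
  have psd_M: "psd_on V ?M"
  proof (rule psd_onI)
    fix i j assume "i \<in> V" "j \<in> V"
    then show "?M i j = ?M j i"
      using sym[of i j] sym[of j i] psd_on_sym[OF X] by (auto simp: W_def)
  next
    fix z :: "'a \<Rightarrow> real"
    have "0 \<le> I (\<lambda>i j. z i * z j)"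
      by (intro first_order psd_on_add X psd_on_scale psd_on_rank_one) simp
    also have "I (\<lambda>i j. z i * z j) = (\<Sum>i\<in>V. (\<Sum>j\<in>V. W i j * z i * z j) + d i * z i * z i)"
      by (simp add: I_def sum.distrib mult.assoc)
    also have "\<dots> = (\<Sum>i\<in>V. \<Sum>j\<in>V. ?M i j * z i * z j)"
    proof (intro sum.cong refl)
      fix i assume i: "i \<in> V"
      have "(\<Sum>j\<in>V. ?M i j * z i * z j)
          = (\<Sum>j\<in>V. W i j * z i * z j + (if i = j then d i * z i * z j else 0))"
        by (intro sum.cong) (auto simp: algebra_simps)
      then show "(\<Sum>j\<in>V. W i j * z i * z j) + d i * z i * z i = (\<Sum>j\<in>V. ?M i j * z i * z j)"
        using i assms(1) by (simp add: sum.distrib)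
    qed
    finally show "0 \<le> (\<Sum>i\<in>V. \<Sum>j\<in>V. ?M i j * z i * z j)" .
  qed
  \<comment> \<open>There are no loops, so \<open>W\<close> vanishes on the diagonal and the
    diagonal of \<open>?M\<close> is \<open>d\<close>.\<close>
  have d_nonneg: "0 \<le> d i" if "i \<in> V" for i
    using psd_on_diag_nonneg[OF psd_M assms(1) that] E[of i i] by (auto simp: W_def split: if_splits)
  let ?sq = "(\<Sum>i\<in>V. \<Sum>j\<in>V. (W i j)\<^sup>2) + (\<Sum>i\<in>V. (d i)\<^sup>2)"
  \<comment> \<open>Moving towards zero stays in the cone, since \<open>X - \<epsilon> * X\<close>
    is a nonnegative multiple of \<open>X\<close> for \<open>\<epsilon> \<le> 1\<close>.\<close>
  have "0 \<le> I (\<lambda>i j. - X i j)"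
  proof (rule first_order)
    fix \<epsilon> :: real assume "0 < \<epsilon>" "\<epsilon> \<le> 1"
    then have "psd_on V (\<lambda>i j. (1 - \<epsilon>) * X i j)" by (intro psd_on_scale X) simp
    then show "psd_on V (\<lambda>i j. X i j + \<epsilon> * - X i j)" by (simp add: algebra_simps)
  qed
  \<comment> \<open>Where \<open>W i j\<close> is nonzero, \<open>X i j = W i j - 1\<close>; on the
    diagonal \<open>X i i = d i + s\<close>.\<close>
  also have "I (\<lambda>i j. - X i j) = (\<Sum>i\<in>V. \<Sum>j\<in>V. W i j - (W i j)\<^sup>2) + (\<Sum>i\<in>V. - (d i)\<^sup>2 - s * d i)"
    unfolding I_def
    by (intro arg_cong2[of _ _ _ _ "(+)"] sum.cong refl)
      (auto simp: W_def d_def max_def power2_eq_square algebra_simps)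
  also have "\<dots> = (\<Sum>i\<in>V. \<Sum>j\<in>V. W i j) - s * (\<Sum>i\<in>V. d i) - ?sq"
    by (simp add: sum_subtractf sum_negf sum_distrib_left)
  finally have gap: "?sq \<le> (\<Sum>i\<in>V. \<Sum>j\<in>V. W i j) - s * (\<Sum>i\<in>V. d i)" by linarith
  \<comment> \<open>If all violations vanished, \<open>X\<close> itself would be a coloring.\<close>
  have "?sq \<noteq> 0"
  proof
    assume z: "?sq = 0"
    have nn: "0 \<le> (\<Sum>i\<in>V. \<Sum>j\<in>V. (W i j)\<^sup>2)" "0 \<le> (\<Sum>i\<in>V. (d i)\<^sup>2)"
      by (intro sum_nonneg; simp)+
    have "(\<Sum>i\<in>V. \<Sum>j\<in>V. (W i j)\<^sup>2) = 0" "(\<Sum>i\<in>V. (d i)\<^sup>2) = 0"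
      using nn z by linarith+
    then have "\<forall>i\<in>V. \<forall>j\<in>V. W i j = 0" "\<forall>i\<in>V. d i = 0"
      using assms(1) by (simp_all add: sum_nonneg_eq_0_iff sum_nonneg)
    then have "gram_coloring V E s X"
      using X E by (fastforce simp: gram_coloring_def W_def d_def)
    then show False using no_coloring by blast
  qed
  moreover have "0 \<le> ?sq" by (intro add_nonneg_nonneg sum_nonneg) auto
  ultimately have sq: "0 < ?sq" by simp
  \<comment> \<open>\<open>d\<close> may vanish somewhere; the strict gap leaves room to make it positive\<close>
  define \<eta> where "\<eta> = ?sq / (s * real (card V) + 1)"
  have sc: "0 \<le> s * real (card V)" using assms(4) by simp
  have \<eta>: "0 < \<eta>" using sq sc by (simp add: \<eta>_def)
  have "\<eta> * (s * real (card V) + 1) = ?sq" using sc by (simp add: \<eta>_def)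
  then have \<eta>_small: "s * (real (card V) * \<eta>) < ?sq" using \<eta> by (simp add: algebra_simps)
  show ?thesis
  proof (rule that[of W "\<lambda>i. d i + \<eta>"])
    show "psd_on V (\<lambda>i j. W i j + (if i = j then d i + \<eta> else 0))"
    proof (rule psd_on_cong[OF psd_on_add[OF psd_M psd_on_diag[of V "\<lambda>_. \<eta>"]]])
    qed (use \<eta> assms(1) in auto)
    show "s * (\<Sum>i\<in>V. d i + \<eta>) < (\<Sum>i\<in>V. \<Sum>j\<in>V. W i j)"
      using gap \<eta>_small by (simp add: sum.distrib distrib_left)
    show "0 < d i + \<eta>" if "i \<in> V" for i using d_nonneg[OF that] \<eta> by simp
  qed (simp_all add: W_def)
qed

text \<open>The Rayleigh quotient \<open>q / N\<close> attains its maximum on the compact ellipsoid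
  \<open>N x = 1\<close>, and maximality is exactly the psd claim. As in Perron-Frobenius, absolute
  values do not decrease \<open>q\<close> because \<open>W\<close> is nonnegative, so a maximiser
  can be chosen nonnegative.\<close>

lemma generalized_top_eigenvector:
  fixes V :: "'a set" and W :: "'a \<Rightarrow> 'a \<Rightarrow> real"
  assumes "finite V" and "V \<noteq> {}" and d: "\<And>i. i \<in> V \<Longrightarrow> 0 < d i"
    and sym: "\<And>i j. i \<in> V \<Longrightarrow> j \<in> V \<Longrightarrow> W i j = W j i" and W: "\<And>i j. 0 \<le> W i j"
  obtains \<alpha> x where "\<And>i. 0 \<le> x i" and "(\<Sum>i\<in>V. d i * (x i)\<^sup>2) = 1"
    and "(\<Sum>i\<in>V. \<Sum>j\<in>V. W i j * x i * x j) = \<alpha>"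
    and "psd_on V (\<lambda>i j. \<alpha> * (if i = j then d i else 0) - W i j)"
proof -
  define q where "q x = (\<Sum>i\<in>V. \<Sum>j\<in>V. W i j * x i * x j)" for x
  define N where "N x = (\<Sum>i\<in>V. d i * (x i)\<^sup>2)" for x
  have N_scale: "N (\<lambda>i. c * x i) = c\<^sup>2 * N x" for c x
    by (simp add: N_def power_mult_distrib sum_distrib_left mult_ac)
  have q_scale: "q (\<lambda>i. c * x i) = c\<^sup>2 * q x" for c x
    by (simp add: q_def power2_eq_square sum_distrib_left mult_ac)
  have N_nonneg: "0 \<le> N x" for x
    unfolding N_def using d by (intro sum_nonneg) (simp add: less_imp_le)
  have N_zero: "x i = 0" if "N x = 0" "i \<in> V" for x i
  proof -
    have "\<forall>i\<in>V. d i * (x i)\<^sup>2 = 0"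
      using that(1) assms(1) d unfolding N_def
      by (subst (asm) sum_nonneg_eq_0_iff) (auto simp: less_imp_le)
    then show ?thesis using that(2) d[OF that(2)] by auto
  qed
  \<comment> \<open>On the ellipsoid each term \<open>d i * (x i)\<^sup>2\<close> is at most 1,
    which confines every coordinate; those off \<open>V\<close> are pinned to 0.\<close>
  let ?B = "\<lambda>i. if i \<in> V then {- sqrt (1 / d i)..sqrt (1 / d i)} else {0::real}"
  define S where "S = {x. \<forall>i. x i \<in> ?B i} \<inter> {x. N x = 1}"
  have S_intro: "(\<lambda>i. if i \<in> V then x i else 0) \<in> S" if x: "N x = 1" for x
  proof -
    have "\<bar>x i\<bar> \<le> sqrt (1 / d i)" if i: "i \<in> V" for i
    proof -
      have "d i * (x i)\<^sup>2 \<le> N x"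
        unfolding N_def using i assms(1) d
        by (intro member_le_sum[of i V "\<lambda>i. d i * (x i)\<^sup>2"]) (auto simp: less_imp_le)
      then have "(x i)\<^sup>2 \<le> 1 / d i" using x d[OF i] by (simp add: field_simps)
      then show ?thesis by (rule real_le_rsqrt[of "\<bar>x i\<bar>", simplified])
    qed
    moreover have "N (\<lambda>i. if i \<in> V then x i else 0) = N x"
      unfolding N_def by (intro sum.cong) auto
    ultimately show ?thesis using x by (auto simp: S_def abs_le_iff minus_le_iff)
  qed
  have cont: "continuous_on A (\<lambda>x. x i)" for A :: "('a \<Rightarrow> real) set" and i
    by (rule continuous_on_product_then_coordinatewise[OF continuous_on_id])
  have "compact S"
    unfolding S_def N_def
    by (intro compact_Int_closed compact_function_box closed_Collect_eq continuous_intros cont) simp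
  moreover have "S \<noteq> {}"
  proof -
    have "N (\<lambda>_. 1) \<noteq> 0" using N_zero[of "\<lambda>_. 1"] assms(2) by auto
    then have pos: "0 < N (\<lambda>_. 1)" using N_nonneg[of "\<lambda>_. 1"] by linarith
    have "N (\<lambda>i. inverse (sqrt (N (\<lambda>_. 1))) * 1) = 1"
      unfolding N_scale using pos by (simp add: power_inverse)
    from S_intro[OF this] show ?thesis by blast
  qed
  moreover have "continuous_on S q"
    unfolding q_def by (intro continuous_intros cont)
  ultimately obtain y where y: "y \<in> S" and max: "\<And>z. z \<in> S \<Longrightarrow> q z \<le> q y"
    using continuous_attains_sup[of S q] by blast
  \<comment> \<open>Both sides are homogeneous of degree 2, so normalising \<open>z\<close>
    suffices; \<open>N z = 0\<close> forces \<open>z\<close> to vanish on \<open>V\<close>.\<close>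
  have bound: "q z \<le> q y * N z" for z
  proof (cases "N z = 0")
    case True
    then have "q z = 0" unfolding q_def using N_zero[of z] by simp
    then show ?thesis using True by simp
  next
    case False
    then have pos: "0 < N z" using N_nonneg[of z] by linarith
    define c where "c = inverse (sqrt (N z))"
    have c: "c\<^sup>2 = inverse (N z)" using pos by (simp add: c_def power_inverse)
    let ?z = "\<lambda>i. if i \<in> V then c * z i else 0"
    have "N (\<lambda>i. c * z i) = 1" unfolding N_scale c using pos by simp
    from max[OF S_intro[OF this]] have "q ?z \<le> q y" .
    also have "q ?z = q (\<lambda>i. c * z i)" unfolding q_def by (intro sum.cong) auto
    also have "\<dots> = q z / N z" unfolding q_scale c by (simp add: divide_inverse mult.commute)
    finally show ?thesis using pos by (simp add: pos_divide_le_eq)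
  qed
  let ?x = "\<lambda>i. \<bar>y i\<bar>"
  have Nx: "N ?x = 1" using y by (simp add: S_def N_def)
  have "q y \<le> q ?x"
    unfolding q_def
  proof (intro sum_mono)
    fix i j
    have "y i * y j \<le> \<bar>y i\<bar> * \<bar>y j\<bar>" by (metis abs_ge_self abs_mult)
    then show "W i j * y i * y j \<le> W i j * \<bar>y i\<bar> * \<bar>y j\<bar>"
      using W[of i j] by (simp add: mult.assoc mult_left_mono)
  qed
  then have qx: "q ?x = q y" using bound[of ?x] Nx by simp
  show ?thesis
  proof (rule that[of ?x "q y"])
    show "psd_on V (\<lambda>i j. q y * (if i = j then d i else 0) - W i j)"
    proof (rule psd_onI)
      fix z :: "'a \<Rightarrow> real"
      have "(\<Sum>i\<in>V. \<Sum>j\<in>V. (q y * (if i = j then d i else 0) - W i j) * z i * z j)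
          = q y * N z - q z"
        unfolding N_def sum_if_eq_diag[OF assms(1), symmetric] q_def[of z]
        by (simp only: sum_distrib_left left_diff_distrib sum_subtractf mult.assoc)
      then show "0 \<le> (\<Sum>i\<in>V. \<Sum>j\<in>V. (q y * (if i = j then d i else 0) - W i j) * z i * z j)"
        using bound[of z] by simp
    qed (use sym in auto)
  qed (use Nx qx in \<open>simp_all add: N_def q_def\<close>)
qed

text \<open>The dual certificate in spectral form: the generalized eigenvalues of
  \<open>(W, D)\<close> lie in \<open>[-1, \<alpha>]\<close> with \<open>s < \<alpha>\<close>, and
  \<open>x\<close> attains the top one.\<close>

lemma spectral_certificate:
  fixes V :: "'a set"
  assumes "finite V" and E: "\<And>i j. (i, j) \<in> E \<Longrightarrow> i \<in> V \<and> j \<in> V \<and> i \<noteq> j"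
    and "\<And>i j. (i, j) \<in> E \<Longrightarrow> (j, i) \<in> E"
    and "0 \<le> s" and "\<And>X. \<not> gram_coloring V E s X"
  obtains W D \<alpha> x where "\<And>i j. 0 \<le> W i j" and "\<And>i j. (i, j) \<notin> E \<Longrightarrow> W i j = 0"
    and "\<And>i j. i \<noteq> j \<Longrightarrow> D i j = 0"
    and "psd_on V (\<lambda>i j. W i j + D i j)" and "psd_on V (\<lambda>i j. \<alpha> * D i j - W i j)" and "s < \<alpha>"
    and "\<And>i. 0 \<le> x i" and "(\<Sum>i\<in>V. \<Sum>j\<in>V. D i j * x i * x j) = 1"
    and "(\<Sum>i\<in>V. \<Sum>j\<in>V. W i j * x i * x j) = \<alpha>"
proof -
  obtain W d where W: "\<And>i j. 0 \<le> W i j" "\<And>i j. (i, j) \<notin> E \<Longrightarrow> W i j = 0"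
    and d: "\<And>i. i \<in> V \<Longrightarrow> 0 < d i"
    and psd: "psd_on V (\<lambda>i j. W i j + (if i = j then d i else 0))"
    and gap: "s * (\<Sum>i\<in>V. d i) < (\<Sum>i\<in>V. \<Sum>j\<in>V. W i j)"
    using coloring_certificate[OF assms] by blast
  \<comment> \<open>For empty \<open>V\<close> both sides of the strict inequality would be
    0.\<close>
  have V: "V \<noteq> {}" using gap by auto
  have sym: "W i j = W j i" if "i \<in> V" "j \<in> V" for i j
    using psd_on_sym[OF psd that] by (cases "i = j") auto
  obtain \<alpha> x where x: "\<And>i. 0 \<le> x i" "(\<Sum>i\<in>V. d i * (x i)\<^sup>2) = 1"
    and \<alpha>: "(\<Sum>i\<in>V. \<Sum>j\<in>V. W i j * x i * x j) = \<alpha>"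
    and top: "psd_on V (\<lambda>i j. \<alpha> * (if i = j then d i else 0) - W i j)"
    using generalized_top_eigenvector[of V d W, OF assms(1) V d sym W(1)] by blast
  have "s < \<alpha>"
  proof -
    \<comment> \<open>The all-ones test vector compares \<open>\<alpha>\<close> with the ratio of
      the total weights, which exceeds \<open>s\<close>.\<close>
    have "0 \<le> (\<Sum>i\<in>V. \<Sum>j\<in>V. \<alpha> * (if i = j then d i else 0) - W i j)"
      using psd_on_nonneg[OF top, of "\<lambda>_. 1"] by simp
    also have "\<dots> = \<alpha> * (\<Sum>i\<in>V. d i) - (\<Sum>i\<in>V. \<Sum>j\<in>V. W i j)"
      using assms(1) by (simp add: sum_subtractf flip: sum_distrib_left)
    finally have "s * (\<Sum>i\<in>V. d i) < \<alpha> * (\<Sum>i\<in>V. d i)" using gap by linarith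
    moreover have "0 < (\<Sum>i\<in>V. d i)" using assms(1) V d by (intro sum_pos)
    ultimately show ?thesis by simp
  qed
  then show ?thesis
    using that[of W "\<lambda>i j. if i = j then d i else 0" \<alpha> x] W psd top x \<alpha>
    by (simp add: sum_if_eq_diag[OF assms(1)])
qed

section \<open>Colorings of the categorical product\<close>

text \<open>Evaluates a Kronecker form at a product vector once the vector entries are absorbed into
  \<open>P\<close> and \<open>Q\<close>.\<close>

lemma sum_product_kernel:
  fixes P :: "'a \<Rightarrow> 'a \<Rightarrow> real" and Q :: "'b \<Rightarrow> 'b \<Rightarrow> real"
  shows "(\<Sum>a\<in>V \<times> U. \<Sum>b\<in>V \<times> U. P (fst a) (fst b) * Q (snd a) (snd b))
    = (\<Sum>i\<in>V. \<Sum>j\<in>V. P i j) * (\<Sum>l\<in>U. \<Sum>k\<in>U. Q l k)"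
proof -
  have "(\<Sum>b\<in>V \<times> U. P (fst a) (fst b) * Q (snd a) (snd b))
      = (\<Sum>j\<in>V. P (fst a) j) * (\<Sum>k\<in>U. Q (snd a) k)" for a
    by (simp only: sum_product sum.cartesian_product') simp
  then have "(\<Sum>a\<in>V \<times> U. \<Sum>b\<in>V \<times> U. P (fst a) (fst b) * Q (snd a) (snd b))
      = (\<Sum>a\<in>V \<times> U. (\<Sum>j\<in>V. P (fst a) j) * (\<Sum>k\<in>U. Q (snd a) k))" by simp
  also have "\<dots> = (\<Sum>i\<in>V. \<Sum>j\<in>V. P i j) * (\<Sum>l\<in>U. \<Sum>k\<in>U. Q l k)"
    by (simp only: sum_product[of "\<lambda>i. \<Sum>j\<in>V. P i j"] sum.cartesian_product') simp
  finally show ?thesis .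
qed

lemma gram_coloring_product:
  fixes V :: "'a set" and U :: "'b set"
  assumes V: "finite V" and E: "\<And>i j. (i, j) \<in> E \<Longrightarrow> i \<in> V \<and> j \<in> V \<and> i \<noteq> j"
    "\<And>i j. (i, j) \<in> E \<Longrightarrow> (j, i) \<in> E"
    and U: "finite U" and F: "\<And>i j. (i, j) \<in> F \<Longrightarrow> i \<in> U \<and> j \<in> U \<and> i \<noteq> j"
    "\<And>i j. (i, j) \<in> F \<Longrightarrow> (j, i) \<in> F"
    and s: "0 \<le> s"
    and X: "gram_coloring (V \<times> U) {((i, l), (j, k)) |i l j k. (i, j) \<in> E \<and> (l, k) \<in> F} s X"
  shows "(\<exists>Y. gram_coloring V E s Y) \<or> (\<exists>Y. gram_coloring U F s Y)"
proof (rule ccontr)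
  assume "\<not> ?thesis"
  then have no: "\<And>Y. \<not> gram_coloring V E s Y" "\<And>Y. \<not> gram_coloring U F s Y" by blast+
  obtain A C \<alpha> x where A: "\<And>i j. 0 \<le> A i j" "\<And>i j. (i, j) \<notin> E \<Longrightarrow> A i j = 0"
    and C: "\<And>i j. i \<noteq> j \<Longrightarrow> C i j = 0"
    and low_A: "psd_on V (\<lambda>i j. A i j + C i j)" and up_A: "psd_on V (\<lambda>i j. \<alpha> * C i j - A i j)"
    and \<alpha>: "s < \<alpha>" and x: "\<And>i. 0 \<le> x i" "(\<Sum>i\<in>V. \<Sum>j\<in>V. C i j * x i * x j) = 1"
    "(\<Sum>i\<in>V. \<Sum>j\<in>V. A i j * x i * x j) = \<alpha>"
    using spectral_certificate[OF V E s no(1)] by blast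
  obtain B D \<beta> y where B: "\<And>i j. 0 \<le> B i j" "\<And>i j. (i, j) \<notin> F \<Longrightarrow> B i j = 0"
    and D: "\<And>i j. i \<noteq> j \<Longrightarrow> D i j = 0"
    and low_B: "psd_on U (\<lambda>i j. B i j + D i j)" and up_B: "psd_on U (\<lambda>i j. \<beta> * D i j - B i j)"
    and \<beta>: "s < \<beta>" and y: "\<And>i. 0 \<le> y i" "(\<Sum>i\<in>U. \<Sum>j\<in>U. D i j * y i * y j) = 1"
    "(\<Sum>i\<in>U. \<Sum>j\<in>U. B i j * y i * y j) = \<beta>"
    using spectral_certificate[OF U F s no(2)] by blast
  \<comment> \<open>On the rectangle of eigenvalue pairs the mixed corners give the products
    \<open>- \<alpha>\<close> and \<open>- \<beta>\<close>; \<open>\<gamma>\<close> is the least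
    shift making both nonnegative.\<close>
  define \<gamma> where "\<gamma> = max \<alpha> \<beta>"
  have \<gamma>: "0 \<le> \<gamma> - \<alpha>" "0 \<le> \<gamma> - \<beta>" "0 \<le> 1 + \<gamma>" "0 \<le> \<alpha> * \<beta> + \<gamma>"
    using \<alpha> \<beta> s by (auto simp: \<gamma>_def intro!: add_nonneg_nonneg mult_nonneg_nonneg)
  note kron = psd_on_kronecker[OF V U]
  let ?N = "\<lambda>a b. A (fst a) (fst b) * B (snd a) (snd b) + \<gamma> * (C (fst a) (fst b) * D (snd a) (snd b))"
  \<comment> \<open>Bernstein form of \<open>p q + \<gamma>\<close>, bilinear in \<open>p \<in> [-1, \<alpha>]\<close> and \<open>q \<in> [-1, \<beta>]\<close>: the coefficients
    are its values at the four corners, all nonnegative\<close>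
  let ?T = "\<lambda>a b. (1 + \<gamma>) * ((\<alpha> * C (fst a) (fst b) - A (fst a) (fst b)) * (\<beta> * D (snd a) (snd b) - B (snd a) (snd b)))
      + (\<gamma> - \<alpha>) * ((A (fst a) (fst b) + C (fst a) (fst b)) * (\<beta> * D (snd a) (snd b) - B (snd a) (snd b)))
      + (\<gamma> - \<beta>) * ((\<alpha> * C (fst a) (fst b) - A (fst a) (fst b)) * (B (snd a) (snd b) + D (snd a) (snd b)))
      + (\<alpha> * \<beta> + \<gamma>) * ((A (fst a) (fst b) + C (fst a) (fst b)) * (B (snd a) (snd b) + D (snd a) (snd b)))"
  have "psd_on (V \<times> U) ?T"
    by (intro psd_on_add psd_on_scale \<gamma> kron[OF up_A up_B] kron[OF low_A up_B] kron[OF up_A low_B] kron[OF low_A low_B])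
  \<comment> \<open>The divisor is the area of the rectangle
    \<open>[-1, \<alpha>] \<times> [-1, \<beta>]\<close>, the normalisation of the bilinear
    Bernstein form.\<close>
  then have "psd_on (V \<times> U) (\<lambda>a b. (1 / ((\<alpha> + 1) * (\<beta> + 1))) * ?T a b)"
    by (rule psd_on_scale) (use \<alpha> \<beta> s in simp)
  then have "psd_on (V \<times> U) ?N"
  proof (rule psd_on_cong)
    have T: "?T a b = ((\<alpha> + 1) * (\<beta> + 1)) * ?N a b" for a b
      by (simp add: algebra_simps)
    have nz: "(\<alpha> + 1) * (\<beta> + 1) \<noteq> 0" using \<alpha> \<beta> s by simp
    show "(1 / ((\<alpha> + 1) * (\<beta> + 1))) * ?T a b = ?N a b" for a b
      unfolding T using nz by simp
  qed
  then have "psd_on (V \<times> U) (\<lambda>a b. ?N a b * X a b)"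
    using X V U by (intro psd_on_schur) (auto simp: gram_coloring_def)
  from psd_on_nonneg[OF this, of "\<lambda>a. x (fst a) * y (snd a)"]
  have "0 \<le> (\<Sum>a\<in>V \<times> U. \<Sum>b\<in>V \<times> U. ?N a b * X a b * (x (fst a) * y (snd a)) * (x (fst b) * y (snd b)))" .
  \<comment> \<open>The first summand of \<open>?N\<close> lives on edges of the product, where
    \<open>X\<close> is at most -1, and the second on the diagonal, where \<open>X\<close> equals
    \<open>s\<close>. Nonnegativity of \<open>x\<close> and \<open>y\<close> lets the entrywise
    estimate survive multiplication by the test vector.\<close>
  also have "\<dots> \<le> (\<Sum>a\<in>V \<times> U. \<Sum>b\<in>V \<times> U.
        - ((A (fst a) (fst b) * x (fst a) * x (fst b)) * (B (snd a) (snd b) * y (snd a) * y (snd b)))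
        + \<gamma> * s * ((C (fst a) (fst b) * x (fst a) * x (fst b)) * (D (snd a) (snd b) * y (snd a) * y (snd b))))"
  proof (intro sum_mono)
    fix a b assume ab: "a \<in> V \<times> U" "b \<in> V \<times> U"
    define z where "z = x (fst a) * y (snd a) * (x (fst b) * y (snd b))"
    have z: "0 \<le> z" by (simp add: z_def x y)
    have "A (fst a) (fst b) * B (snd a) (snd b) * X a b \<le> A (fst a) (fst b) * B (snd a) (snd b) * (- 1)"
    proof (cases "(fst a, fst b) \<in> E \<and> (snd a, snd b) \<in> F")
      case True
      then have "(a, b) \<in> {((i, l), (j, k)) |i l j k. (i, j) \<in> E \<and> (l, k) \<in> F}"
        by (cases a; cases b) auto
      then have "X a b \<le> - 1" using X unfolding gram_coloring_def by blast
      then show ?thesis using A(1) B(1) by (intro mult_left_mono) auto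
    qed (use A(2) B(2) in auto)
    then have "A (fst a) (fst b) * B (snd a) (snd b) * X a b * z \<le> A (fst a) (fst b) * B (snd a) (snd b) * (- 1) * z"
      using z by (rule mult_right_mono)
    moreover have "C (fst a) (fst b) * D (snd a) (snd b) * X a b = C (fst a) (fst b) * D (snd a) (snd b) * s"
    proof (cases "a = b")
      case True
      then show ?thesis using X ab unfolding gram_coloring_def by auto
    next
      case False
      then show ?thesis using C D by (auto simp: prod_eq_iff)
    qed
    ultimately have "A (fst a) (fst b) * B (snd a) (snd b) * X a b * z
        + \<gamma> * (C (fst a) (fst b) * D (snd a) (snd b) * X a b) * z
      \<le> A (fst a) (fst b) * B (snd a) (snd b) * (- 1) * z
        + \<gamma> * (C (fst a) (fst b) * D (snd a) (snd b) * s) * z"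
      by (simp only: add_le_cancel_right)
    then show "?N a b * X a b * (x (fst a) * y (snd a)) * (x (fst b) * y (snd b))
      \<le> - ((A (fst a) (fst b) * x (fst a) * x (fst b)) * (B (snd a) (snd b) * y (snd a) * y (snd b)))
        + \<gamma> * s * ((C (fst a) (fst b) * x (fst a) * x (fst b)) * (D (snd a) (snd b) * y (snd a) * y (snd b)))"
      by (simp add: z_def algebra_simps)
  qed
  also have "\<dots> = - (\<alpha> * \<beta>) + \<gamma> * s"
  proof -
    have "(\<Sum>a\<in>V \<times> U. \<Sum>b\<in>V \<times> U.
        (A (fst a) (fst b) * x (fst a) * x (fst b)) * (B (snd a) (snd b) * y (snd a) * y (snd b))) = \<alpha> * \<beta>"
      using sum_product_kernel[of "\<lambda>i j. A i j * x i * x j" "\<lambda>i j. B i j * y i * y j" V U] x y by simp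
    moreover have "(\<Sum>a\<in>V \<times> U. \<Sum>b\<in>V \<times> U.
        (C (fst a) (fst b) * x (fst a) * x (fst b)) * (D (snd a) (snd b) * y (snd a) * y (snd b))) = 1"
      using sum_product_kernel[of "\<lambda>i j. C i j * x i * x j" "\<lambda>i j. D i j * y i * y j" V U] x y by simp
    ultimately show ?thesis
      by (simp only: sum.distrib sum_negf mult_1_right flip: sum_distrib_left)
  qed
  finally have le: "\<alpha> * \<beta> \<le> \<gamma> * s" by simp
  \<comment> \<open>The larger of \<open>\<alpha>\<close> and \<open>\<beta>\<close> is positive and
    cancels, leaving the smaller one at most \<open>s\<close>.\<close>
  show False
  proof (cases "\<alpha> \<le> \<beta>")
    case True
    then have "\<beta> * s < \<alpha> * \<beta>" using \<alpha> \<beta> s by (simp add: mult.commute)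
    then show False using le True by (simp add: \<gamma>_def)
  next
    case False
    then have "\<alpha> * s < \<alpha> * \<beta>" using \<alpha> \<beta> s by simp
    then show False using le False by (simp add: \<gamma>_def)
  qed
qed

section \<open>From colorings to chromatic numbers\<close>

lemma vector_coloring_product_iff:
  assumes "pair_graph G" and "pair_graph H" and "1 \<le> t"
  shows "(\<exists>d p. vector_coloring (categorical_product G H) t d p)
    \<longleftrightarrow> (\<exists>d p. vector_coloring G t d p) \<or> (\<exists>d p. vector_coloring H t d p)"
proof
  interpret G: pair_graph G by fact
  interpret H: pair_graph H by fact
  assume "\<exists>d p. vector_coloring (categorical_product G H) t d p"
  then obtain X where "gram_coloring (pverts G \<times> pverts H)
      {((i, l), (j, k)) |i l j k. (i, j) \<in> parcs G \<and> (l, k) \<in> parcs H} (t - 1) X"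
    unfolding vector_coloring_iff_gram[OF pair_graph_categorical_product[OF assms(1,2)]]
    by (auto simp: categorical_product_def)
  then have "(\<exists>Y. gram_coloring (pverts G) (parcs G) (t - 1) Y) \<or> (\<exists>Y. gram_coloring (pverts H) (parcs H) (t - 1) Y)"
  proof (rule gram_coloring_product[rotated -1])
    show "(j, i) \<in> parcs G" if "(i, j) \<in> parcs G" for i j
      using that G.sym_arcs by (auto simp: symmetric_def sym_def)
    show "(j, i) \<in> parcs H" if "(i, j) \<in> parcs H" for i j
      using that H.sym_arcs by (auto simp: symmetric_def sym_def)
  qed (use assms(3) in \<open>auto dest: G.wellformed' H.wellformed' G.no_loops' H.no_loops'\<close>)
  then show "(\<exists>d p. vector_coloring G t d p) \<or> (\<exists>d p. vector_coloring H t d p)"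
    unfolding vector_coloring_iff_gram[OF assms(1)] vector_coloring_iff_gram[OF assms(2)] .
next
  assume "(\<exists>d p. vector_coloring G t d p) \<or> (\<exists>d p. vector_coloring H t d p)"
  then consider d p where "vector_coloring G t d p" | d p where "vector_coloring H t d p" by blast
  then show "\<exists>d p. vector_coloring (categorical_product G H) t d p"
  proof cases
    case (1 d p)
    then have "vector_coloring (categorical_product G H) t d (p \<circ> fst)"
      by (auto simp: vector_coloring_def categorical_product_def)
    then show ?thesis by blast
  next
    case (2 d p)
    then have "vector_coloring (categorical_product G H) t d (p \<circ> snd)"
      by (auto simp: vector_coloring_def categorical_product_def)
    then show ?thesis by blast
  qed
qed

text \<open>\<open>LEAST\<close> over the reals carries information only once a minimum is known to
  exist. Compactness supplies it for nonempty graphs; the empty graph has a coloring for every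
  \<open>t\<close>, so there the constraint \<open>1 \<le> t\<close> decides.\<close>

lemma vector_chromatic_number_attained:
  fixes G :: "'a pair_pre_digraph"
  assumes "pair_graph G"
  shows "1 \<le> vector_chromatic_number G" and "\<exists>d p. vector_coloring G (vector_chromatic_number G) d p"
    and "\<And>t d p. 1 \<le> t \<Longrightarrow> vector_coloring G t d p \<Longrightarrow> vector_chromatic_number G \<le> t"
proof -
  interpret pair_graph G by fact
  obtain m where m: "1 \<le> m" "\<exists>d p. vector_coloring G m d p"
    "\<And>t. 1 \<le> t \<Longrightarrow> \<exists>d p. vector_coloring G t d p \<Longrightarrow> m \<le> t"
  proof (cases "pverts G = {}")
    case True
    then have "vector_coloring G 1 0 p" for p by (simp add: vector_coloring_def)
    then show ?thesis using that[of 1] by blast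
  next
    case False
    have sub: "parcs G \<subseteq> pverts G \<times> pverts G" by (auto dest: wellformed')
    have irr: "(i, i) \<notin> parcs G" for i using no_loops' by blast
    obtain s where s: "0 \<le> s" "\<exists>X. gram_coloring (pverts G) (parcs G) s X"
      "\<And>s' X. gram_coloring (pverts G) (parcs G) s' X \<Longrightarrow> s \<le> s'"
      using least_gram_coloring[OF pair_finite_verts False sub irr] by metis
    show ?thesis
    proof (rule that[of "s + 1"])
      show "\<exists>d p. vector_coloring G (s + 1) d p"
        unfolding vector_coloring_iff_gram[OF assms] using s(2) by simp
      show "s + 1 \<le> t" if "\<exists>d p. vector_coloring G t d p" for t
        using that s(3)[of "t - 1"] unfolding vector_coloring_iff_gram[OF assms] by fastforce
    qed (use s(1) in simp)
  qed
  have "vector_chromatic_number G = m"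
    unfolding vector_chromatic_number_def using m by (intro Least_equality) blast+
  then show "1 \<le> vector_chromatic_number G" "\<exists>d p. vector_coloring G (vector_chromatic_number G) d p"
    "\<And>t d p. 1 \<le> t \<Longrightarrow> vector_coloring G t d p \<Longrightarrow> vector_chromatic_number G \<le> t"
    using m by blast+
qed

theorem mainTheorem1:
  fixes G :: "'a pair_pre_digraph" and H :: "'b pair_pre_digraph"
  assumes "pair_graph G" and "pair_graph H"
  shows "vector_chromatic_number (categorical_product G H) =
    min (vector_chromatic_number G) (vector_chromatic_number H)"
proof -
  note G = vector_chromatic_number_attained[OF assms(1)]
  note H = vector_chromatic_number_attained[OF assms(2)]
  note P = vector_coloring_product_iff[OF assms]
  have "(LEAST t. t \<ge> 1 \<and> (\<exists>d p. vector_coloring (categorical_product G H) t d p))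
    = min (vector_chromatic_number G) (vector_chromatic_number H)"
  \<comment> \<open>The value is attained by lifting an optimal coloring of the factor with the
    smaller number. It is least because a coloring of the product forces one of a factor at the same
    \<open>t\<close>.\<close>
  proof (rule Least_equality, intro conjI)
    show "1 \<le> min (vector_chromatic_number G) (vector_chromatic_number H)"
      using G(1) H(1) by simp
    then show "\<exists>d p. vector_coloring (categorical_product G H)
        (min (vector_chromatic_number G) (vector_chromatic_number H)) d p"
      using G(2) H(2) by (simp only: P) (simp add: min_def)
    fix t :: real
    assume "1 \<le> t \<and> (\<exists>d p. vector_coloring (categorical_product G H) t d p)"
    then show "min (vector_chromatic_number G) (vector_chromatic_number H) \<le> t"
      using P[of t] G(3) H(3) by (metis min.coboundedI1 min.coboundedI2)
  qed
  then show ?thesis by (simp only: vector_chromatic_number_def[of "categorical_product G H"])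
qed

end
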